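(* Let $m>4$, and let $V(n,m)$, the equivalence relation $\simeq$ on $V(n,m)$, and the set $\mathbb{M}(n,m)\subset V(n,m)$ be as defined in the context. Then $\mathbb{M}(n,m)$ is a parameter space of $V(n,m)/\simeq$; that is, assigning to each $\simeq$-equivalence class a representative lying in $\mathbb{M}(n,m)$ gives a bijection $V(n,m)/\simeq\;\to\;\mathbb{M}(n,m)$.
   Context: $n$ and $m$ are positive integers. $\mathbb{H}$ denotes the quaternions with standard units $\mathbf{i},\mathbf{j},\mathbf{k}$; $\mathbb{C}=\{x_0+x_1\mathbf{i}\}\subset\mathbb{H}$; $\mathrm{Sp}(1)$ is the group of unit quaternions. A quaternionic Hermitian $m\times m$ matrix $A$ has signature $i(A)=(n_+,n_-,n_0)$ if there is an invertible quaternionic matrix $B$ with $B^*AB$ diagonal having $n_+$ entries $1$, $n_-$ entries $-1$ and $n_0$ entries $0$ on the diagonal. Put $N=\frac{(m-1)(m-2)}{2}$. For $v=(v_1,\dots,v_N)\in\mathbb{H}^N$, $G(v)=(g_{ij})$ is the Hermitian $m\times m$ matrix with $g_{ii}=0$ for all $i$, $g_{i-1,i}=1$ for $i=2,\dots,m$, and whose remaining entries above the diagonal are given by $(g_{13},g_{14},g_{24},\dots,g_{1m},g_{2m},\dots,g_{m-2,m})=v$. $V(n,m)$ is the set of $v=(v_1,\dots,v_N)\in\mathbb{H}^N$, with $v_1=-e^{-\mathbf{i}\mathbb{A}}$ for some $\mathbb{A}\in[0,\pi/2]$, such that $i(G(v))=(n_+,n_-,n_0)$ with $n_+\le n$ and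 $n_-=1$. For $v\in\mathbb{H}^N$ let $\mathbf{O}_v=\{(\mu v_1\mu^{-1},\dots,\mu v_N\mu^{-1}):\mu\in\mathrm{Sp}(1)\}$. For $v,w\in V(n,m)$, $v\simeq w$ means $\mathbf{O}_v=\mathbf{O}_w$. Let $\mathbb{R}^{1+}=\{x_0+x_1\mathbf{i}: x_0,x_1\in\mathbb{R},\ x_1>0\}$ and $\mathbb{R}^{2+}=\{x_0+x_1\mathbf{i}+x_2\mathbf{j}: x_0,x_1,x_2\in\mathbb{R},\ x_2>0\}$. Define the following subsets of $V(n,m)$: - $P(\mathbb{C})=\{v\in V(n,m): v_1\notin\mathbb{R},\ v_l\in\mathbb{C}\text{ for } l=2,\dots,N\}$; - $P(j)=\{v\in V(n,m): v_1\notin\mathbb{R},\ v_l\in\mathbb{C}\text{ for } l<j,\ v_j\in\mathbb{R}^{2+}\}$, $j=2,\dots,N$; - $Z(\mathbb{R})=\{v\in V(n,m): v_l\in\mathbb{R}\text{ for } l=1,\dots,N\}$; - $Z(\mathbb{C},i)=\{v\in V(n,m): v_l\in\mathbb{R}\text{ for } l<i,\ v_i\in\mathbb{R}^{1+}\}$, $i=2,\dots,N$; - $Z(i,j)=\{v\in V(n,m): v_l\in\mathbb{R}\text{ for } l<i,\ v_i\in\mathbb{R}^{1+},\ v_l\in\mathbb{C}\text{ for } l<j,\ v_j\in\mathbb{R}^{2+}\}$, $j=2,\dots,N$, $2\le i<j$. $\mathbb{M}(n,m)=P(n,m)\cup Z(n,m)$, where $P(n,m)$ is the union of $P(\mathbb{C})$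 and all the $P(j)$, and $Z(n,m)$ is the union of $Z(\mathbb{R})$, all the $Z(\mathbb{C},i)$ and all the $Z(i,j)$.
   Formalization: In the definition of Z(ℂ,i), the condition v_l∈ℂ for l>i is added; without it, for n≥2, Z(ℂ,i) contains several points of one orbit and the claim is false, while for n=1 the set Z(n,m) is empty and nothing changes. *)

theory Defs
  imports "HOL-Analysis.Analysis" "Jordan_Normal_Form.Matrix"
begin

section \<open>Quaternions\<close>

text \<open>\<open>Quat a b c d\<close> stands for a + b i + c j + d k.\<close>

datatype quat = Quat (qRe: real) (qI: real) (qJ: real) (qK: real)

lemma quat_eq_iff: "x = y \<longleftrightarrow> qRe x = qRe y \<and> qI x = qI y \<and> qJ x = qJ y \<and> qK x = qK y"
  by (auto intro: quat.expand)

instantiation quat :: real_vector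
begin

definition zero_quat :: quat where "0 = Quat 0 0 0 0"

definition plus_quat :: "quat \<Rightarrow> quat \<Rightarrow> quat" where
  "x + y = Quat (qRe x + qRe y) (qI x + qI y) (qJ x + qJ y) (qK x + qK y)"

definition uminus_quat :: "quat \<Rightarrow> quat" where
  "- x = Quat (- qRe x) (- qI x) (- qJ x) (- qK x)"

definition minus_quat :: "quat \<Rightarrow> quat \<Rightarrow> quat" where
  "x - y = Quat (qRe x - qRe y) (qI x - qI y) (qJ x - qJ y) (qK x - qK y)"

definition scaleR_quat :: "real \<Rightarrow> quat \<Rightarrow> quat" where
  "r *\<^sub>R x = Quat (r * qRe x) (r * qI x) (r * qJ x) (r * qK x)"

instance
  by standard (simp_all add: quat_eq_iff zero_quat_def plus_quat_def uminus_quat_def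
      minus_quat_def scaleR_quat_def algebra_simps)

end

instantiation quat :: real_algebra_1
begin

definition one_quat :: quat where "1 = Quat 1 0 0 0"

definition times_quat :: "quat \<Rightarrow> quat \<Rightarrow> quat" where
  "x * y = Quat
     (qRe x * qRe y - qI x * qI y - qJ x * qJ y - qK x * qK y)
     (qRe x * qI y + qI x * qRe y + qJ x * qK y - qK x * qJ y)
     (qRe x * qJ y - qI x * qK y + qJ x * qRe y + qK x * qI y)
     (qRe x * qK y + qI x * qJ y - qJ x * qI y + qK x * qRe y)"

instance
  by standard (simp_all add: quat_eq_iff zero_quat_def plus_quat_def one_quat_def
      times_quat_def scaleR_quat_def algebra_simps)

end

instantiation quat :: real_inner
begin

definition inner_quat :: "quat \<Rightarrow> quat \<Rightarrow> real" where
  "inner x y = qRe x * qRe y + qI x * qI y + qJ x * qJ y + qK x * qK y"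

definition norm_quat :: "quat \<Rightarrow> real" where
  "norm x = sqrt ((qRe x)\<^sup>2 + (qI x)\<^sup>2 + (qJ x)\<^sup>2 + (qK x)\<^sup>2)"

definition sgn_quat :: "quat \<Rightarrow> quat" where
  "sgn (x :: quat) = x /\<^sub>R norm x"

definition dist_quat :: "quat \<Rightarrow> quat \<Rightarrow> real" where
  "dist (x :: quat) y = norm (x - y)"

definition uniformity_quat :: "(quat \<times> quat) filter" where
  "uniformity = (INF e\<in>{0<..}. principal {(x :: quat, y). dist x y < e})"

definition open_quat :: "quat set \<Rightarrow> bool" where
  "open (U :: quat set) \<longleftrightarrow> (\<forall>x\<in>U. eventually (\<lambda>(x', y). x' = x \<longrightarrow> y \<in> U) uniformity)"

instance
proof
  fix x y z :: quat and r :: real and U :: "quat set"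
  show "inner x y = inner y x"
    by (simp add: inner_quat_def mult.commute)
  show "inner (x + y) z = inner x z + inner y z"
    by (simp add: inner_quat_def plus_quat_def algebra_simps)
  show "inner (r *\<^sub>R x) y = r * inner x y"
    by (simp add: inner_quat_def scaleR_quat_def algebra_simps)
  show "0 \<le> inner x x"
    by (simp add: inner_quat_def)
  show "inner x x = 0 \<longleftrightarrow> x = 0"
    by (auto simp: inner_quat_def quat_eq_iff zero_quat_def add_nonneg_eq_0_iff)
  show "norm x = sqrt (inner x x)"
    by (simp add: norm_quat_def inner_quat_def power2_eq_square)
qed (simp_all add: sgn_quat_def dist_quat_def uniformity_quat_def open_quat_def)

end

definition qcnj :: "quat \<Rightarrow> quat" where
  "qcnj x = Quat (qRe x) (- qI x) (- qJ x) (- qK x)"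

instantiation quat :: real_normed_div_algebra
begin

definition inverse_quat :: "quat \<Rightarrow> quat" where
  "inverse (x :: quat) = qcnj x /\<^sub>R (norm x)\<^sup>2"

definition divide_quat :: "quat \<Rightarrow> quat \<Rightarrow> quat" where
  "x div y = x * inverse (y :: quat)"

instance
proof
  fix x y :: quat
  have n2: "(norm z)\<^sup>2 = (qRe z)\<^sup>2 + (qI z)\<^sup>2 + (qJ z)\<^sup>2 + (qK z)\<^sup>2" for z :: quat
    by (simp add: norm_quat_def)
  show "inverse x * x = 1" if "x \<noteq> 0"
  proof -
    have "(norm x)\<^sup>2 \<noteq> 0" using that by simp
    moreover have "qcnj x * x = (norm x)\<^sup>2 *\<^sub>R 1"
      unfolding n2 by (simp add: qcnj_def times_quat_def one_quat_def scaleR_quat_def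
          power2_eq_square algebra_simps)
    ultimately show ?thesis by (simp add: inverse_quat_def)
  qed
  show "x * inverse x = 1" if "x \<noteq> 0"
  proof -
    have "(norm x)\<^sup>2 \<noteq> 0" using that by simp
    moreover have "x * qcnj x = (norm x)\<^sup>2 *\<^sub>R 1"
      unfolding n2 by (simp add: qcnj_def times_quat_def one_quat_def scaleR_quat_def
          power2_eq_square algebra_simps)
    ultimately show ?thesis by (simp add: inverse_quat_def)
  qed
  show "x div y = x * inverse y"
    by (rule divide_quat_def)
  show "inverse (0 :: quat) = 0"
    by (simp add: inverse_quat_def)
  show "norm (x * y) = norm x * norm y"
    unfolding norm_quat_def real_sqrt_mult[symmetric]
    by (rule arg_cong[where f = sqrt])
      (simp add: times_quat_def power2_eq_square algebra_simps)
qed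

end

lemma quat_units:
  "Quat 0 1 0 0 * Quat 0 1 0 0 = -1" "Quat 0 0 1 0 * Quat 0 0 1 0 = -1"
  "Quat 0 1 0 0 * Quat 0 0 1 0 = Quat 0 0 0 1"
  "Quat 0 0 1 0 * Quat 0 0 0 1 = Quat 0 1 0 0"
  "Quat 0 0 0 1 * Quat 0 1 0 0 = Quat 0 0 1 0"
  by (simp_all add: times_quat_def uminus_quat_def one_quat_def)

definition quat_of_complex :: "complex \<Rightarrow> quat" where
  "quat_of_complex z = Quat (Re z) (Im z) 0 0"

text \<open>The copies of R and C inside the quaternions are \<open>\<real> :: quat set\<close> and \<open>qComplex\<close>.\<close>

lemma Reals_quat: "x \<in> \<real> \<longleftrightarrow> qI x = 0 \<and> qJ x = 0 \<and> qK x = 0"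
  by (auto simp: Reals_def of_real_def one_quat_def scaleR_quat_def image_iff quat_eq_iff)

definition qComplex :: "quat set" where
  "qComplex = range quat_of_complex"

definition Sp1 :: "quat set" where
  "Sp1 = {\<mu>. norm \<mu> = 1}"

definition R1plus :: "quat set" where
  "R1plus = {Quat x0 x1 0 0 | x0 x1. x1 > 0}"

definition R2plus :: "quat set" where
  "R2plus = {Quat x0 x1 x2 0 | x0 x1 x2. x2 > 0}"

section \<open>Signature of a quaternionic Hermitian matrix\<close>

definition qadjoint :: "quat mat \<Rightarrow> quat mat" where
  "qadjoint A = Matrix.mat (dim_col A) (dim_row A) (\<lambda>(i, j). qcnj (A $$ (j, i)))"

definition qhermitian :: "nat \<Rightarrow> quat mat \<Rightarrow> bool" where
  "qhermitian m A \<longleftrightarrow> A \<in> carrier_mat m m \<and> qadjoint A = A"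

definition has_signature :: "nat \<Rightarrow> quat mat \<Rightarrow> nat \<times> nat \<times> nat \<Rightarrow> bool" where
  "has_signature m A = (\<lambda>(p, q, z). qhermitian m A \<and>
     (\<exists>B \<in> carrier_mat m m. invertible_mat B \<and>
        (let D = qadjoint B * A * B in
           diagonal_mat D \<and>
           (\<forall>i<m. D $$ (i, i) \<in> {1, -1, 0}) \<and>
           card {i. i < m \<and> D $$ (i, i) = 1} = p \<and>
           card {i. i < m \<and> D $$ (i, i) = -1} = q \<and>
           card {i. i < m \<and> D $$ (i, i) = 0} = z)))"

section \<open>The normalised Gram matrix and the space V(n,m)\<close>

definition NN :: "nat \<Rightarrow> nat" where
  "NN m = (m - 1) * (m - 2) div 2"

text \<open>Library vectors and matrices are indexed from 0; \<open>coord v l\<close> is the entry \<open>v\<^sub>l\<close>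
  (l = 1, ..., N) in the indexing from 1 that is used below.\<close>

definition coord :: "quat vec \<Rightarrow> nat \<Rightarrow> quat" where
  "coord v l = vec_index v (l - 1)"

text \<open>Position of \<open>g\<^sub>i\<^sub>j\<close>, 1 \<le> i \<le> j - 2, in the enumeration
  g13, g14, g24, g15, g25, g35, ...: the columns 3, ..., j - 1
  contribute 1 + 2 + ... + (j - 3) entries before column j starts.\<close>

definition gram_pos :: "nat \<Rightarrow> nat \<Rightarrow> nat" where
  "gram_pos i j = (j - 2) * (j - 3) div 2 + i"

lemma gram_pos_examples:
  "map (\<lambda>(i, j). gram_pos i j) [(1,3), (1,4), (2,4), (1,5), (2,5), (3,5)] = [1, 2, 3, 4, 5, 6]"
  "gram_pos (m - 2) m = NN m" if "m \<ge> 3"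
proof -
  show "map (\<lambda>(i, j). gram_pos i j) [(1,3), (1,4), (2,4), (1,5), (2,5), (3,5)] = [1, 2, 3, 4, 5, 6]"
    by (simp add: gram_pos_def)
  have "(k + 2) * (k + 1) = (k + 1) * k + (k + 1) * 2" for k :: nat
    by (simp add: algebra_simps)
  then have "(k + 2) * (k + 1) div 2 = (k + 1) * k div 2 + (k + 1)" for k :: nat
    by (metis div_mult_self3 add.commute zero_neq_numeral)
  from this[of "m - 3"] show "gram_pos (m - 2) m = NN m"
    using that by (simp add: gram_pos_def NN_def numeral_eq_Suc Suc_diff_Suc)
qed

definition gram_entry :: "quat vec \<Rightarrow> nat \<Rightarrow> nat \<Rightarrow> quat" where
  "gram_entry v i j =
     (if i = j then 0
      else if j = i + 1 \<or> i = j + 1 then 1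
      else if i < j then coord v (gram_pos i j)
      else qcnj (coord v (gram_pos j i)))"

definition gram :: "nat \<Rightarrow> quat vec \<Rightarrow> quat mat" where
  "gram m v = Matrix.mat m m (\<lambda>(a, b). gram_entry v (a + 1) (b + 1))"

definition V_nm :: "nat \<Rightarrow> nat \<Rightarrow> quat vec set" where
  "V_nm n m = {v \<in> carrier_vec (NN m).
     (\<exists>A::real \<in> {0..pi/2}. coord v 1 = - quat_of_complex (exp (- \<i> * complex_of_real A))) \<and>
     (\<exists>p q z. has_signature m (gram m v) (p, q, z) \<and> p \<le> n \<and> q = 1)}"

definition orbit_of :: "quat vec \<Rightarrow> quat vec set" where
  "orbit_of v = {map_vec (\<lambda>x. \<mu> * x * inverse \<mu>) v | \<mu>. \<mu> \<in> Sp1}"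

definition orb_rel :: "nat \<Rightarrow> nat \<Rightarrow> (quat vec \<times> quat vec) set" where
  "orb_rel n m = {(v, w). v \<in> V_nm n m \<and> w \<in> V_nm n m \<and> orbit_of v = orbit_of w}"

lemma equiv_orb_rel: "equiv (V_nm n m) (orb_rel n m)"
  by (auto simp: equiv_def refl_on_def sym_def trans_def orb_rel_def)

section \<open>The parameter set M(n,m)\<close>

definition P_C :: "nat \<Rightarrow> nat \<Rightarrow> quat vec set" where
  "P_C n m = {v \<in> V_nm n m. coord v 1 \<notin> \<real> \<and> (\<forall>l\<in>{2..NN m}. coord v l \<in> qComplex)}"

definition P_j :: "nat \<Rightarrow> nat \<Rightarrow> nat \<Rightarrow> quat vec set" where
  "P_j n m j = {v \<in> V_nm n m. coord v 1 \<notin> \<real> \<and>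
     (\<forall>l\<in>{1..<j}. coord v l \<in> qComplex) \<and> coord v j \<in> R2plus}"

definition Z_R :: "nat \<Rightarrow> nat \<Rightarrow> quat vec set" where
  "Z_R n m = {v \<in> V_nm n m. \<forall>l\<in>{1..NN m}. coord v l \<in> \<real>}"

text \<open>The entries after the i-th one are required to be complex, in parallel with \<open>P_C\<close>.
  Without this condition \<open>Z_C\<close> would contain every \<open>Z_ij n m i j\<close>, and also several points
  of one orbit: for n \<ge> 2, m = 5 the vectors
  (-1, 1 + i, -2 - i + 2 u, 0, (1 + i)/2, -(1 + i)/2) with u = j and u = k.\<close>

definition Z_C :: "nat \<Rightarrow> nat \<Rightarrow> nat \<Rightarrow> quat vec set" where
  "Z_C n m i = {v \<in> V_nm n m. (\<forall>l\<in>{1..<i}. coord v l \<in> \<real>) \<and> coord v i \<in> R1plus \<and>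
     (\<forall>l\<in>{i<..NN m}. coord v l \<in> qComplex)}"

definition Z_ij :: "nat \<Rightarrow> nat \<Rightarrow> nat \<Rightarrow> nat \<Rightarrow> quat vec set" where
  "Z_ij n m i j = {v \<in> V_nm n m. (\<forall>l\<in>{1..<i}. coord v l \<in> \<real>) \<and> coord v i \<in> R1plus \<and>
     (\<forall>l\<in>{1..<j}. coord v l \<in> qComplex) \<and> coord v j \<in> R2plus}"

definition P_nm :: "nat \<Rightarrow> nat \<Rightarrow> quat vec set" where
  "P_nm n m = P_C n m \<union> (\<Union>j\<in>{2..NN m}. P_j n m j)"

definition Z_nm :: "nat \<Rightarrow> nat \<Rightarrow> quat vec set" where
  "Z_nm n m = Z_R n m \<union> (\<Union>i\<in>{2..NN m}. Z_C n m i) \<union> (\<Union>j\<in>{2..NN m}. \<Union>i\<in>{2..<j}. Z_ij n m i j)"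

definition M_nm :: "nat \<Rightarrow> nat \<Rightarrow> quat vec set" where
  "M_nm n m = P_nm n m \<union> Z_nm n m"

lemma M_subset_V: "M_nm n m \<subseteq> V_nm n m"
  by (auto simp: M_nm_def P_nm_def Z_nm_def P_C_def P_j_def Z_R_def Z_C_def Z_ij_def)

end

theory Submission
  imports Defs
begin

text \<open>Conjugation by a unit quaternion rotates imaginary parts and fixes the reals. Rotate the first
  non-real entry of v into the open ray spanned by i over \<open>\<real>\<close>; what remains of the stabiliser is
  the circle of unit complex numbers, which rotates the plane spanned by j and k and is used to
  bring the first non-complex entry into \<open>R2plus\<close>. The element that remains is then fixed by all
  admissible conjugations, so every orbit has exactly one such normal form. The set \<open>M_nm\<close> consists
  precisely of the normal forms, and the first entry is never moved because it already has a
  nonnegative i-component; the signature is unchanged because conjugation is a ring automorphism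
  commuting with \<open>qcnj\<close>.\<close>

section \<open>Conjugation of quaternions\<close>

text \<open>Defined for every \<open>\<mu>\<close> and not only on \<open>Sp1\<close>: the
  intertwining elements constructed below are in general not of norm 1, and \<open>qconj_sgn\<close>
  normalises them afterwards.\<close>

definition qconj :: "quat \<Rightarrow> quat \<Rightarrow> quat" where
  "qconj \<mu> x = \<mu> * x * inverse \<mu>"

text \<open>Clearing the inverse leaves an intertwining relation, which in coordinates is a
  polynomial identity.\<close>

lemma qconj_eqI:
  assumes "\<mu> \<noteq> 0" "\<mu> * x = y * \<mu>" shows "qconj \<mu> x = y"
  using assms by (simp add: qconj_def mult.assoc)

lemma qconj_eqD:
  assumes "\<mu> \<noteq> 0" "qconj \<mu> x = y" shows "\<mu> * x = y * \<mu>"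
  using assms by (auto simp: qconj_def mult.assoc)

lemma qconj_one [simp]: "qconj 1 x = x"
  by (simp add: qconj_def)

lemma qconj_mult_left:
  assumes "\<mu> \<noteq> 0" "\<nu> \<noteq> 0" shows "qconj (\<mu> * \<nu>) x = qconj \<mu> (qconj \<nu> x)"
  using assms by (simp add: qconj_def nonzero_inverse_mult_distrib mult.assoc)

lemma qconj_inverse_left:
  assumes "\<mu> \<noteq> 0" shows "qconj (inverse \<mu>) (qconj \<mu> x) = x"
  using assms qconj_mult_left[of "inverse \<mu>" \<mu> x] by simp

lemma qconj_sgn: "qconj (sgn \<mu>) x = qconj \<mu> x" if "\<mu> \<noteq> 0"
  using that by (simp add: qconj_def sgn_div_norm inverse_scaleR_distrib)

lemma Sp1_nonzero: "\<mu> \<in> Sp1 \<Longrightarrow> \<mu> \<noteq> 0"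
  by (auto simp: Sp1_def)

lemma one_in_Sp1 [simp]: "1 \<in> Sp1"
  by (simp add: Sp1_def)

lemma Sp1_mult: "\<mu> \<in> Sp1 \<Longrightarrow> \<nu> \<in> Sp1 \<Longrightarrow> \<mu> * \<nu> \<in> Sp1"
  by (simp add: Sp1_def norm_mult)

lemma Sp1_inverse: "\<mu> \<in> Sp1 \<Longrightarrow> inverse \<mu> \<in> Sp1"
  by (simp add: Sp1_def norm_inverse)

lemma sgn_in_Sp1: "\<mu> \<noteq> 0 \<Longrightarrow> sgn \<mu> \<in> Sp1"
  by (simp add: Sp1_def norm_sgn)

lemma inverse_Sp1: "\<mu> \<in> Sp1 \<Longrightarrow> inverse \<mu> = qcnj \<mu>"
  by (simp add: Sp1_def inverse_quat_def)

lemma qcnj_mult: "qcnj (x * y) = qcnj y * qcnj x"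
  by (simp add: qcnj_def times_quat_def algebra_simps)

lemma qcnj_qcnj [simp]: "qcnj (qcnj x) = x"
  by (simp add: qcnj_def)

text \<open>For a unit \<open>\<mu>\<close> the inverse is \<open>qcnj \<mu>\<close>, so the
  reversal of factors by \<open>qcnj\<close> reproduces the same pair of outer factors.\<close>

lemma qcnj_qconj: "\<mu> \<in> Sp1 \<Longrightarrow> qcnj (qconj \<mu> x) = qconj \<mu> (qcnj x)"
  by (simp add: qconj_def inverse_Sp1 qcnj_mult mult.assoc)

lemma qconj_add: "qconj \<mu> (x + y) = qconj \<mu> x + qconj \<mu> y"
  by (simp add: qconj_def algebra_simps)

lemma qconj_mult: "\<mu> \<noteq> 0 \<Longrightarrow> qconj \<mu> (x * y) = qconj \<mu> x * qconj \<mu> y"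
  by (simp add: qconj_def) (metis left_inverse mult.assoc mult.left_neutral)

lemma qconj_zero [simp]: "qconj \<mu> 0 = 0"
  by (simp add: qconj_def)

lemma qconj_unit [simp]: "\<mu> \<noteq> 0 \<Longrightarrow> qconj \<mu> 1 = 1"
  by (simp add: qconj_def)

lemma qconj_minus: "qconj \<mu> (- x) = - qconj \<mu> x"
  by (simp add: qconj_def)

lemma qconj_Reals:
  assumes "\<mu> \<noteq> 0" "x \<in> \<real>" shows "qconj \<mu> x = x"
  using assms by (auto elim!: Reals_cases simp: qconj_def of_real_def)

lemma qconj_in_Reals_iff:
  assumes "\<mu> \<noteq> 0" shows "qconj \<mu> x \<in> \<real> \<longleftrightarrow> x \<in> \<real>"
  by (metis assms inverse_nonzero_iff_nonzero qconj_Reals qconj_inverse_left)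

lemma qRe_mult_commute: "qRe (x * y) = qRe (y * x)"
  by (simp add: times_quat_def algebra_simps)

lemma qRe_qconj: "\<mu> \<noteq> 0 \<Longrightarrow> qRe (qconj \<mu> x) = qRe x"
  using qRe_mult_commute[of "\<mu> * x" "inverse \<mu>"] by (simp add: qconj_def mult.assoc[symmetric])

lemma norm_qconj: "\<mu> \<noteq> 0 \<Longrightarrow> norm (qconj \<mu> x) = norm x"
  by (simp add: qconj_def norm_mult norm_inverse)

section \<open>Coordinate descriptions of the distinguished subsets\<close>

lemma qComplex_iff: "x \<in> qComplex \<longleftrightarrow> qJ x = 0 \<and> qK x = 0"
proof
  assume "qJ x = 0 \<and> qK x = 0"
  then have "x = quat_of_complex (Complex (qRe x) (qI x))"
    by (simp add: quat_of_complex_def quat_eq_iff)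
  then show "x \<in> qComplex" by (simp add: qComplex_def)
qed (auto simp: qComplex_def quat_of_complex_def)

lemma R1plus_iff: "x \<in> R1plus \<longleftrightarrow> qI x > 0 \<and> qJ x = 0 \<and> qK x = 0"
  unfolding R1plus_def by (cases x) auto

lemma R2plus_iff: "x \<in> R2plus \<longleftrightarrow> qJ x > 0 \<and> qK x = 0"
  unfolding R2plus_def by (cases x) auto

lemma R1plus_complex: "x \<in> R1plus \<Longrightarrow> x \<in> qComplex"
  by (simp add: R1plus_iff qComplex_iff)

lemma R1plus_not_real: "x \<in> R1plus \<Longrightarrow> x \<notin> \<real>"
  by (simp add: R1plus_iff Reals_quat)

lemma R2plus_not_complex: "x \<in> R2plus \<Longrightarrow> x \<notin> qComplex"
  by (simp add: R2plus_iff qComplex_iff)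

lemma Reals_complex: "x \<in> \<real> \<Longrightarrow> x \<in> (qComplex :: quat set)"
  by (simp add: Reals_quat qComplex_iff)

lemma qconj_complex:
  assumes "\<mu> \<noteq> 0" "\<mu> \<in> qComplex" "x \<in> qComplex"
  shows "qconj \<mu> x = x"
  using assms by (intro qconj_eqI) (simp_all add: qComplex_iff times_quat_def)

section \<open>Rotation into \<open>R1plus\<close> and \<open>R2plus\<close>, and the remaining
  freedom\<close>

lemma ex_qconj_R1plus:
  assumes "x \<notin> \<real>" shows "\<exists>\<mu>\<in>Sp1. qconj \<mu> x \<in> R1plus"
proof -
  obtain a p q r where x: "x = Quat a p q r" by (cases x)
  \<comment> \<open>Conjugation preserves the real part and the norm, so the only possible image in
    \<open>R1plus\<close> is a + b i, where b is the length of the imaginary part.\<close>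
  define b where "b = sqrt (p\<^sup>2 + q\<^sup>2 + r\<^sup>2)"
  have pos: "p\<^sup>2 + q\<^sup>2 + r\<^sup>2 > 0"
    using assms by (auto simp: x Reals_quat add_nonneg_eq_0_iff
        intro!: order.not_eq_order_implies_strict dest!: sym[of 0])
  then have b: "b > 0" "b * b = p * p + q * q + r * r"
    by (simp_all add: b_def power2_eq_square)
  \<comment> \<open>With u the imaginary part of x, the element \<open>b - i u\<close> intertwines u and \<open>b i\<close>; it vanishes
    only for \<open>u = - b i\<close>.\<close>
  define \<mu> where "\<mu> = (if b + p = 0 then Quat 0 0 1 0 else Quat (b + p) 0 r (- q))"
  have nz: "\<mu> \<noteq> 0" by (auto simp: \<mu>_def zero_quat_def)
  have "\<mu> * x = Quat a b 0 0 * \<mu>"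
  proof (cases "b + p = 0")
    \<comment> \<open>Here x = a - b i, and conjugation by j sends i to -i.\<close>
    case True
    then have "p = - b" by simp
    with b(2) have "q = 0" "r = 0" by (auto simp: sum_squares_eq_zero_iff)
    with \<open>p = - b\<close> show ?thesis by (simp add: \<mu>_def x times_quat_def)
  next
    case False
    then show ?thesis using b(2) by (simp add: \<mu>_def x times_quat_def algebra_simps)
  qed
  then have "qconj \<mu> x = Quat a b 0 0" by (rule qconj_eqI[OF nz])
  then show ?thesis
    using nz b(1) by (intro bexI[of _ "sgn \<mu>"]) (simp_all add: qconj_sgn sgn_in_Sp1 R1plus_iff)
qed

lemma ex_qconj_R2plus:
  assumes "x \<notin> qComplex" shows "\<exists>\<mu>\<in>Sp1 \<inter> qComplex. qconj \<mu> x \<in> R2plus"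
proof -
  obtain a p q r where x: "x = Quat a p q r" by (cases x)
  define b where "b = sqrt (q\<^sup>2 + r\<^sup>2)"
  have "q\<^sup>2 + r\<^sup>2 > 0"
    using assms by (simp add: x qComplex_iff sum_power2_gt_zero_iff)
  then have b: "b > 0" "b * b = q * q + r * r"
    by (simp_all add: b_def power2_eq_square)
  \<comment> \<open>Write the part of x outside the complex plane as z j with z = q + r i, so that b
    is the modulus of z. With z' the complex conjugate of z, \<open>\<mu>\<close> is b + z'; it
    works because (b + z') z = b (b + z) and w j = j w' for complex w. It vanishes only for z = -b,
    where i serves instead, since conjugation by i negates j.\<close>
  define \<mu> where "\<mu> = (if b + q = 0 then Quat 0 1 0 0 else Quat (b + q) (- r) 0 0)"
  have nz: "\<mu> \<noteq> 0" by (auto simp: \<mu>_def zero_quat_def)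
  have "\<mu> * x = Quat a p b 0 * \<mu>"
  proof (cases "b + q = 0")
    case True
    then have "q = - b" by simp
    with b(2) have "r = 0" by auto
    with \<open>q = - b\<close> show ?thesis by (simp add: \<mu>_def x times_quat_def)
  next
    case False
    then show ?thesis using b(2) by (simp add: \<mu>_def x times_quat_def algebra_simps)
  qed
  then have "qconj \<mu> x = Quat a p b 0" by (rule qconj_eqI[OF nz])
  moreover have "sgn \<mu> \<in> qComplex"
    by (simp add: \<mu>_def qComplex_iff sgn_div_norm scaleR_quat_def)
  ultimately show ?thesis
    using nz b(1) by (intro bexI[of _ "sgn \<mu>"]) (simp_all add: qconj_sgn sgn_in_Sp1 R2plus_iff)
qed

text \<open>Real part and norm are invariants, and together with the positive sign of the
  i-component they determine a point of \<open>R1plus\<close>. Hence \<open>\<mu>\<close> commutes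
  with a non-real complex number, which forces it to be complex.\<close>

lemma R1plus_qconj_unique:
  assumes "\<mu> \<noteq> 0" "x \<in> R1plus" "qconj \<mu> x \<in> R1plus"
  shows "qconj \<mu> x = x" "\<mu> \<in> qComplex"
proof -
  obtain a b where x: "x = Quat a b 0 0" "b > 0" using assms(2) by (auto simp: R1plus_def)
  obtain c d where y: "qconj \<mu> x = Quat c d 0 0" "d > 0" using assms(3) by (auto simp: R1plus_def)
  have "a = c" using qRe_qconj[OF assms(1), of x] x y by simp
  moreover have "a\<^sup>2 + b\<^sup>2 = c\<^sup>2 + d\<^sup>2"
    using norm_qconj[OF assms(1), of x] x y by (simp add: norm_quat_def)
  ultimately have "b = d" using x(2) y(2) by (simp add: power2_eq_iff_nonneg)
  with \<open>a = c\<close> show eq: "qconj \<mu> x = x" using x y by simp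
  have "\<mu> * x = x * \<mu>" using qconj_eqD[OF assms(1) eq] .
  then show "\<mu> \<in> qComplex" using x by (simp add: times_quat_def qComplex_iff)
qed

text \<open>Comparing k-components in the intertwining relation makes the i-component of
  \<open>\<mu>\<close> a zero of multiplication by the sum of two positive j-components.\<close>

lemma R2plus_qconj_unique:
  assumes "\<mu> \<in> qComplex" "\<mu> \<noteq> 0" "x \<in> R2plus" "qconj \<mu> x \<in> R2plus"
  shows "\<mu> \<in> \<real>"
proof -
  obtain s t where \<mu>: "\<mu> = Quat s t 0 0" using assms(1)
    by (cases \<mu>) (auto simp: qComplex_iff)
  obtain a b c where x: "x = Quat a b c 0" "c > 0" using assms(3) by (auto simp: R2plus_def)
  obtain a' b' c' where y: "qconj \<mu> x = Quat a' b' c' 0" "c' > 0"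
    using assms(4) by (auto simp: R2plus_def)
  have "\<mu> * x = Quat a' b' c' 0 * \<mu>" using qconj_eqD[OF assms(2) y(1)] .
  then have e: "t * c = - (c' * t)" by (simp add: \<mu> x times_quat_def)
  have "t * (c + c') = 0" using e by (simp add: algebra_simps)
  with x(2) y(2) have "t = 0" by simp
  then show ?thesis by (simp add: \<mu> Reals_quat)
qed

lemma qconj_real_left: "\<mu> \<noteq> 0 \<Longrightarrow> \<mu> \<in> \<real> \<Longrightarrow> qconj \<mu> x = x"
  by (intro qconj_eqI) (auto elim!: Reals_cases simp: of_real_def)

section \<open>Invariance of the signature\<close>

text \<open>Gives access to the facts \<open>mat_hom_mult\<close> and \<open>mat_hom_one\<close> on
  entrywise images of matrix products and identities.\<close>

lemma semiring_hom_qconj: "\<mu> \<noteq> 0 \<Longrightarrow> semiring_hom (qconj \<mu>)"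
  by unfold_locales (simp_all add: qconj_add qconj_mult)

lemma invertible_mat_qconj:
  assumes "\<mu> \<noteq> 0" "invertible_mat B" shows "invertible_mat (map_mat (qconj \<mu>) B)"
proof -
  interpret semiring_hom "qconj \<mu>" by (rule semiring_hom_qconj[OF assms(1)])
  obtain C where sq: "dim_row B = dim_col B"
    and BC: "B * C = 1\<^sub>m (dim_row B)" and CB: "C * B = 1\<^sub>m (dim_row C)"
    using assms(2) by (auto simp: invertible_mat_def inverts_mat_def)
  have B: "B \<in> carrier_mat (dim_row B) (dim_row B)" using sq by auto
  \<comment> \<open>\<open>inverts_mat\<close> does not fix the shape of the inverse; its dimensions
    are read off from the two product equations.\<close>
  have "dim_col C = dim_row B" using arg_cong[OF BC, of dim_col] by simp
  moreover have "dim_row C = dim_row B" using arg_cong[OF CB, of dim_col] sq by simp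
  ultimately have C: "C \<in> carrier_mat (dim_row B) (dim_row B)" by auto
  have "map_mat (qconj \<mu>) B * map_mat (qconj \<mu>) C = 1\<^sub>m (dim_row B)"
    using mat_hom_mult[OF B C] BC by (simp add: mat_hom_one)
  moreover have "map_mat (qconj \<mu>) C * map_mat (qconj \<mu>) B = 1\<^sub>m (dim_row C)"
    using mat_hom_mult[OF C B] CB by (simp add: mat_hom_one)
  ultimately show ?thesis
    using sq by (auto simp: invertible_mat_def inverts_mat_def)
qed

lemma qadjoint_qconj:
  "\<mu> \<in> Sp1 \<Longrightarrow> qadjoint (map_mat (qconj \<mu>) A) = map_mat (qconj \<mu>) (qadjoint A)"
  by (rule eq_matI) (auto simp: qadjoint_def qcnj_qconj)

text \<open>Applying \<open>qconj \<mu>\<close> to the congruence that diagonalises A yields a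
  congruence for the image of A. The diagonal form has only the real entries 1, -1 and 0, so it is
  fixed and all counts stay the same.\<close>

lemma has_signature_qconj:
  assumes \<mu>: "\<mu> \<in> Sp1" and A: "has_signature m A s"
  shows "has_signature m (map_mat (qconj \<mu>) A) s"
proof -
  note nz = Sp1_nonzero[OF \<mu>]
  interpret semiring_hom "qconj \<mu>" by (rule semiring_hom_qconj[OF nz])
  obtain p q z where s: "s = (p, q, z)" by (cases s)
  obtain B where herm: "qhermitian m A" and B: "B \<in> carrier_mat m m" "invertible_mat B"
    and D: "diagonal_mat (qadjoint B * A * B)"
      "\<forall>i<m. (qadjoint B * A * B) $$ (i, i) \<in> {1, -1, 0}"
      "card {i. i < m \<and> (qadjoint B * A * B) $$ (i, i) = 1} = p"
      "card {i. i < m \<and> (qadjoint B * A * B) $$ (i, i) = -1} = q"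
      "card {i. i < m \<and> (qadjoint B * A * B) $$ (i, i) = 0} = z"
    using A unfolding has_signature_def s by (auto simp: Let_def)
  have Ac: "A \<in> carrier_mat m m" using herm by (simp add: qhermitian_def)
  have Bc: "qadjoint B \<in> carrier_mat m m" using B by (auto simp: qadjoint_def)
  let ?D = "qadjoint B * A * B"
  have Dc: "?D \<in> carrier_mat m m" using Ac Bc B by auto
  have "map_mat (qconj \<mu>) ?D = ?D"
  proof (rule eq_matI)
    fix i j assume ij: "i < dim_row ?D" "j < dim_col ?D"
    then have lt: "i < m" "j < m" using Dc by auto
    have "qconj \<mu> (?D $$ (i, j)) = ?D $$ (i, j)"
    proof (cases "i = j")
      case True
      with D(2) lt have "?D $$ (i, j) \<in> {1, -1, 0}" by blast
      then show ?thesis using nz by (auto simp del: index_mult_mat simp: qconj_minus)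
    next
      case False
      then have "?D $$ (i, j) = 0" using D(1) ij by (simp add: diagonal_mat_def)
      then show ?thesis by (simp del: index_mult_mat)
    qed
    then show "map_mat (qconj \<mu>) ?D $$ (i, j) = ?D $$ (i, j)"
      using ij by (simp del: index_mult_mat(1))
  qed auto
  moreover have "map_mat (qconj \<mu>) ?D =
      qadjoint (map_mat (qconj \<mu>) B) * map_mat (qconj \<mu>) A * map_mat (qconj \<mu>) B"
    using mat_hom_mult[OF mult_carrier_mat[OF Bc Ac] B(1)] mat_hom_mult[OF Bc Ac]
    by (simp add: qadjoint_qconj[OF \<mu>])
  ultimately have E: "qadjoint (map_mat (qconj \<mu>) B) * map_mat (qconj \<mu>) A * map_mat (qconj \<mu>) B = ?D"
    by simp
  have "qhermitian m (map_mat (qconj \<mu>) A)"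
    using herm by (auto simp: qhermitian_def qadjoint_qconj[OF \<mu>])
  then show ?thesis
    unfolding has_signature_def s prod.case Let_def
    using B invertible_mat_qconj[OF nz B(2)] D
    by (intro conjI bexI[of _ "map_mat (qconj \<mu>) B"]) (simp_all only: E map_carrier_mat)
qed

section \<open>Coordinates and Gram matrices under conjugation\<close>

lemma coord_map_vec:
  "v \<in> carrier_vec N \<Longrightarrow> l \<in> {1..N} \<Longrightarrow> coord (map_vec f v) l = f (coord v l)"
  by (auto simp: coord_def)

lemma coord_ext:
  assumes "v \<in> carrier_vec N" "w \<in> carrier_vec N" "\<And>l. l \<in> {1..N} \<Longrightarrow> coord v l = coord w l"
  shows "v = w"
proof (rule eq_vecI)
  fix i assume "i < dim_vec w"
  then show "vec_index v i = vec_index w i" using assms(2) assms(3)[of "Suc i"]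
    by (auto simp: coord_def)
qed (use assms in auto)

text \<open>The last entry of column j sits at position \<open>NN j\<close>, and \<open>NN\<close>
  is monotone.\<close>

lemma gram_pos_bounds:
  assumes "1 \<le> i" "i + 2 \<le> j" "j \<le> m" shows "gram_pos i j \<in> {1..NN m}"
proof -
  have "gram_pos i j \<le> gram_pos (j - 2) j" using assms by (simp add: gram_pos_def)
  also have "\<dots> = NN j" using assms by (intro gram_pos_examples) auto
  also have "\<dots> \<le> NN m"
    using assms unfolding NN_def by (intro div_le_mono mult_le_mono) auto
  finally show ?thesis using assms by (simp add: gram_pos_def)
qed

text \<open>The prescribed entries 0 and 1 are fixed by conjugation, and the entries below the
  diagonal are compatible by \<open>qcnj_qconj\<close>.\<close>

lemma gram_qconj:
  assumes "\<mu> \<in> Sp1" "v \<in> carrier_vec (NN m)"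
  shows "gram m (map_vec (qconj \<mu>) v) = map_mat (qconj \<mu>) (gram m v)"
proof (rule eq_matI)
  fix a b assume "a < dim_row (map_mat (qconj \<mu>) (gram m v))"
    "b < dim_col (map_mat (qconj \<mu>) (gram m v))"
  then have lt: "a < m" "b < m" by (simp_all add: gram_def)
  have c: "coord (map_vec (qconj \<mu>) v) (gram_pos i j) = qconj \<mu> (coord v (gram_pos i j))"
    if "1 \<le> i" "i + 2 \<le> j" "j \<le> m" for i j
    by (rule coord_map_vec[OF assms(2) gram_pos_bounds[OF that]])
  show "gram m (map_vec (qconj \<mu>) v) $$ (a, b) = map_mat (qconj \<mu>) (gram m v) $$ (a, b)"
    using lt Sp1_nonzero[OF assms(1)]
    by (auto simp: gram_def gram_entry_def c qcnj_qconj[OF assms(1)])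
qed (simp_all add: gram_def)

text \<open>The signature condition is always preserved, whereas the arc prescribed for the first
  coordinate is not; this is why that coordinate is assumed to stay in place.\<close>

lemma V_nm_qconj:
  assumes "\<mu> \<in> Sp1" "v \<in> V_nm n m" "coord (map_vec (qconj \<mu>) v) 1 = coord v 1"
  shows "map_vec (qconj \<mu>) v \<in> V_nm n m"
proof -
  have v: "v \<in> carrier_vec (NN m)" using assms(2) by (simp add: V_nm_def)
  obtain p q z where "has_signature m (gram m v) (p, q, z)" "p \<le> n" "q = 1"
    using assms(2) unfolding V_nm_def by blast
  moreover from this(1) have "has_signature m (gram m (map_vec (qconj \<mu>) v)) (p, q, z)"
    unfolding gram_qconj[OF assms(1) v] by (rule has_signature_qconj[OF assms(1)])
  ultimately show ?thesis
    using assms(2,3) v unfolding V_nm_def mem_Collect_eq map_carrier_vec by metis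
qed

section \<open>Normal forms\<close>

text \<open>Each clause speaks of a single index at most, the first non-real or the first
  non-complex entry, and is vacuous if there is none. Thus all the families making up
  \<open>M_nm\<close> are treated uniformly.\<close>

definition normal_form :: "nat \<Rightarrow> quat vec \<Rightarrow> bool" where
  "normal_form N v \<longleftrightarrow>
     (\<forall>i\<in>{1..N}. (\<forall>l\<in>{1..<i}. coord v l \<in> \<real>) \<longrightarrow> coord v i \<notin> \<real> \<longrightarrow> coord v i \<in> R1plus) \<and>
     (\<forall>j\<in>{1..N}. (\<forall>l\<in>{1..<j}. coord v l \<in> qComplex) \<longrightarrow> coord v j \<notin> qComplex \<longrightarrow> coord v j \<in> R2plus)"

lemma first_failure:
  fixes N :: nat
  obtains "\<forall>l\<in>{1..N}. P l" | i where "i \<in> {1..N}" "\<forall>l\<in>{1..<i}. P l" "\<not> P i"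
proof (cases "\<forall>l\<in>{1..N}. P l")
  case False
  define i where "i = (LEAST l. l \<in> {1..N} \<and> \<not> P l)"
  have i: "i \<in> {1..N} \<and> \<not> P i"
    unfolding i_def by (rule LeastI_ex) (use False in blast)
  moreover have "P l" if "l \<in> {1..<i}" for l
    using not_less_Least[of l "\<lambda>l. l \<in> {1..N} \<and> \<not> P l", folded i_def] that i by auto
  ultimately show thesis using that(2) by blast
qed (rule that(1))

text \<open>Passes from an existential witness, as in the definition of the families, to the first
  failing index: the two agree because \<open>R1plus\<close> avoids the reals and
  \<open>R2plus\<close> avoids the complex numbers.\<close>

lemma normal_formI:
  assumes "(\<forall>l\<in>{1..N}. coord v l \<in> \<real>) \<or>
      (\<exists>i\<in>{1..N}. (\<forall>l\<in>{1..<i}. coord v l \<in> \<real>) \<and> coord v i \<in> R1plus)"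
    and "(\<forall>l\<in>{1..N}. coord v l \<in> qComplex) \<or>
      (\<exists>j\<in>{1..N}. (\<forall>l\<in>{1..<j}. coord v l \<in> qComplex) \<and> coord v j \<in> R2plus)"
  shows "normal_form N v"
proof -
  have *: "Q (coord v k)"
    if k: "(\<forall>l\<in>{1..N}. P (coord v l)) \<or> (\<exists>i\<in>{1..N}. (\<forall>l\<in>{1..<i}. P (coord v l)) \<and> Q (coord v i))"
      "\<And>x. Q x \<Longrightarrow> \<not> P x" "k \<in> {1..N}" "\<forall>l\<in>{1..<k}. P (coord v l)" "\<not> P (coord v k)"
    for P Q :: "quat \<Rightarrow> bool" and k
  proof -
    obtain i where i: "i \<in> {1..N}" "\<forall>l\<in>{1..<i}. P (coord v l)" "Q (coord v i)"
      using k(1,3,5) by blast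
    moreover have "\<not> P (coord v i)" using k(2) i(3) by blast
    ultimately have "i = k" using k(3-5) by (cases i k rule: linorder_cases) auto
    with i show ?thesis by simp
  qed
  show ?thesis
    unfolding normal_form_def
    using *[of "\<lambda>x. x \<in> \<real>" "\<lambda>x. x \<in> R1plus"] *[of "\<lambda>x. x \<in> qComplex" "\<lambda>x. x \<in> R2plus"]
      assms R1plus_not_real R2plus_not_complex by blast
qed

text \<open>If all entries are real, nothing moves. Otherwise the first non-real entry forces
  \<open>\<mu>\<close> to be complex; then either all entries are complex and stay fixed, or the
  first non-complex entry forces \<open>\<mu>\<close> to be real.\<close>

lemma normal_form_unique:
  assumes v: "v \<in> carrier_vec N" "normal_form N v"
    and \<mu>: "\<mu> \<in> Sp1" and w: "normal_form N (map_vec (qconj \<mu>) v)"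
  shows "map_vec (qconj \<mu>) v = v"
proof (rule coord_ext)
  note nz = Sp1_nonzero[OF \<mu>]
  note c = coord_map_vec[OF v(1), of _ "qconj \<mu>"]
  fix k assume k: "k \<in> {1..N}"
  consider "\<forall>l\<in>{1..N}. coord v l \<in> \<real>"
    | i where "i \<in> {1..N}" "\<forall>l\<in>{1..<i}. coord v l \<in> \<real>" "coord v i \<notin> \<real>"
    by (rule first_failure[of N "\<lambda>l. coord v l \<in> \<real>"]) blast+
  then show "coord (map_vec (qconj \<mu>) v) k = coord v k"
  proof cases
    case 1
    then show ?thesis using c k qconj_Reals[OF nz] by auto
  next
    case (2 i)
    have "coord v i \<in> R1plus" using v(2) 2 unfolding normal_form_def by blast
    moreover have "\<forall>l\<in>{1..<i}. coord (map_vec (qconj \<mu>) v) l \<in> \<real>"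
      using 2 c qconj_in_Reals_iff[OF nz] by auto
    then have "qconj \<mu> (coord v i) \<in> R1plus"
      using w 2 c[of i] qconj_in_Reals_iff[OF nz] unfolding normal_form_def by metis
    ultimately have C: "\<mu> \<in> qComplex" using R1plus_qconj_unique[OF nz] by blast
    consider "\<forall>l\<in>{1..N}. coord v l \<in> qComplex"
      | j where "j \<in> {1..N}" "\<forall>l\<in>{1..<j}. coord v l \<in> qComplex" "coord v j \<notin> qComplex"
      by (rule first_failure[of N "\<lambda>l. coord v l \<in> qComplex"]) blast+
    then show ?thesis
    proof cases
      case 1
      then show ?thesis using c k qconj_complex[OF nz C] by auto
    next
      case (2 j)
      have vj: "coord v j \<in> R2plus" using v(2) 2 unfolding normal_form_def by blast
      \<comment> \<open>A complex image would commute with the complex \<open>\<mu>\<close>;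
        cancelling \<open>\<mu>\<close> would identify it with the non-complex entry itself.\<close>
      have "qconj \<mu> (coord v j) \<notin> qComplex"
      proof
        assume *: "qconj \<mu> (coord v j) \<in> qComplex"
        then have "\<mu> * coord v j = qconj \<mu> (coord v j) * \<mu>" by (simp add: qconj_eqD[OF nz])
        also have "\<dots> = \<mu> * qconj \<mu> (coord v j)"
          using qconj_eqD[OF nz qconj_complex[OF nz C *]] by simp
        finally have "coord v j = qconj \<mu> (coord v j)" using nz by simp
        with * 2 show False by simp
      qed
      moreover have "\<forall>l\<in>{1..<j}. coord (map_vec (qconj \<mu>) v) l \<in> qComplex"
        using 2 c qconj_complex[OF nz C] by auto
      ultimately have "qconj \<mu> (coord v j) \<in> R2plus"
        using w 2 c[of j] unfolding normal_form_def by metis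
      then have "\<mu> \<in> \<real>" using R2plus_qconj_unique[OF C nz vj] by blast
      then show ?thesis using c[OF k] qconj_real_left[OF nz] by simp
    qed
  qed
qed (use v in auto)

text \<open>Two rotations in succession: the first settles the real clause, the second is by a
  complex unit and settles the complex clause without disturbing the first.\<close>

lemma ex_normal_form:
  assumes v: "v \<in> carrier_vec N" and N: "1 \<le> N" and v1: "coord v 1 \<in> \<real> \<or> coord v 1 \<in> R1plus"
  shows "\<exists>\<mu>\<in>Sp1. coord (map_vec (qconj \<mu>) v) 1 = coord v 1 \<and> normal_form N (map_vec (qconj \<mu>) v)"
proof -
  let ?real1 = "\<lambda>w. \<forall>i\<in>{1..N}. (\<forall>l\<in>{1..<i}. coord w l \<in> \<real>) \<longrightarrow> coord w i \<notin> \<real> \<longrightarrow> coord w i \<in> R1plus"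
  have "\<exists>\<mu>\<in>Sp1. coord (map_vec (qconj \<mu>) v) 1 = coord v 1 \<and> ?real1 (map_vec (qconj \<mu>) v)"
  proof (cases "?real1 v")
    case True
    moreover have "map_vec (qconj 1) v = v" by (rule eq_vecI) auto
    ultimately show ?thesis by (intro bexI[of _ 1]) simp_all
  next
    case False
    then obtain i where i: "i \<in> {1..N}" "\<forall>l\<in>{1..<i}. coord v l \<in> \<real>" "coord v i \<notin> \<real>"
      "coord v i \<notin> R1plus" by blast
    obtain \<mu> where \<mu>: "\<mu> \<in> Sp1" "qconj \<mu> (coord v i) \<in> R1plus"
      using ex_qconj_R1plus[OF i(3)] by blast
    note nz = Sp1_nonzero[OF \<mu>(1)]
    note c = coord_map_vec[OF v, of _ "qconj \<mu>"]
    \<comment> \<open>The first coordinate is real or already in \<open>R1plus\<close>, so it cannot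
      be the offending one; it precedes i, hence is real and stays fixed.\<close>
    have "i \<noteq> 1" using i v1 by auto
    then have "coord v 1 \<in> \<real>" using i by auto
    then have "coord (map_vec (qconj \<mu>) v) 1 = coord v 1"
      using c[of 1] N qconj_Reals[OF nz] by simp
    moreover have "?real1 (map_vec (qconj \<mu>) v)"
    proof (intro ballI impI)
      fix k assume k: "k \<in> {1..N}" "\<forall>l\<in>{1..<k}. coord (map_vec (qconj \<mu>) v) l \<in> \<real>"
        "coord (map_vec (qconj \<mu>) v) k \<notin> \<real>"
      have "\<forall>l\<in>{1..<k}. coord v l \<in> \<real>" "coord v k \<notin> \<real>"
        using k c qconj_in_Reals_iff[OF nz] by auto
      then have "k = i" using i k(1) by (metis atLeastAtMost_iff atLeastLessThan_iff nat_neq_iff)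
      then show "coord (map_vec (qconj \<mu>) v) k \<in> R1plus" using \<mu> c i by simp
    qed
    ultimately show ?thesis using \<mu>(1) by blast
  qed
  then obtain \<mu> where \<mu>: "\<mu> \<in> Sp1" "coord (map_vec (qconj \<mu>) v) 1 = coord v 1"
    "?real1 (map_vec (qconj \<mu>) v)" by blast
  define w where "w = map_vec (qconj \<mu>) v"
  have w: "w \<in> carrier_vec N" "coord w 1 = coord v 1" "?real1 w" using \<mu> v by (simp_all add: w_def)
  show ?thesis
  proof (rule first_failure[of N "\<lambda>l. coord w l \<in> qComplex"])
    assume "\<forall>l\<in>{1..N}. coord w l \<in> qComplex"
    with w(3) have "normal_form N w" unfolding normal_form_def by blast
    with \<mu> show ?thesis unfolding w_def by blast
  next
    fix j assume j: "j \<in> {1..N}" "\<forall>l\<in>{1..<j}. coord w l \<in> qComplex" "coord w j \<notin> qComplex"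
    obtain \<nu> where \<nu>: "\<nu> \<in> Sp1" "\<nu> \<in> qComplex" "qconj \<nu> (coord w j) \<in> R2plus"
      using ex_qconj_R2plus[OF j(3)] by blast
    note nz = Sp1_nonzero[OF \<nu>(1)]
    note c = coord_map_vec[OF w(1), of _ "qconj \<nu>"]
    define u where "u = map_vec (qconj \<nu>) w"
    have u: "u = map_vec (qconj (\<nu> * \<mu>)) v"
      unfolding u_def w_def
      by (rule eq_vecI) (simp_all add: qconj_mult_left nz Sp1_nonzero[OF \<mu>(1)])
    have "coord v 1 \<in> qComplex" using v1 Reals_complex R1plus_complex by blast
    then have "coord u 1 = coord v 1"
      using c[of 1] N qconj_complex[OF nz \<nu>(2)] w(2) by (simp add: u_def)
    \<comment> \<open>Conjugation preserves being real or non-real, so the first non-real index is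
      the same for u and w. Its entry lies in \<open>R1plus\<close> and is therefore fixed by the
      complex \<open>\<nu>\<close>.\<close>
    moreover have "?real1 u"
    proof (intro ballI impI)
      fix k assume k: "k \<in> {1..N}" "\<forall>l\<in>{1..<k}. coord u l \<in> \<real>" "coord u k \<notin> \<real>"
      have "\<forall>l\<in>{1..<k}. coord w l \<in> \<real>" "coord w k \<notin> \<real>"
        using k c qconj_in_Reals_iff[OF nz] by (auto simp: u_def)
      with w(3) k(1) have "coord w k \<in> R1plus" by blast
      then show "coord u k \<in> R1plus"
        using c[OF k(1)] qconj_complex[OF nz \<nu>(2)] R1plus_complex by (simp add: u_def)
    qed
    moreover have uj: "coord u j \<in> R2plus" using c[OF j(1)] \<nu> by (simp add: u_def)
    have uC: "\<forall>l\<in>{1..<j}. coord u l \<in> qComplex"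
      using c j qconj_complex[OF nz \<nu>(2)] by (auto simp: u_def)
    have "k = j" if "k \<in> {1..N}" "\<forall>l\<in>{1..<k}. coord u l \<in> qComplex" "coord u k \<notin> qComplex" for k
      using that uC R2plus_not_complex[OF uj] j(1) by (cases k j rule: linorder_cases) auto
    then have "\<forall>k\<in>{1..N}. (\<forall>l\<in>{1..<k}. coord u l \<in> qComplex) \<longrightarrow> coord u k \<notin> qComplex \<longrightarrow>
        coord u k \<in> R2plus"
      using uj by blast
    ultimately have "coord u 1 = coord v 1 \<and> normal_form N u"
      unfolding normal_form_def by blast
    then show ?thesis using u Sp1_mult[OF \<nu>(1) \<mu>(1)] by metis
  qed
qed

section \<open>The parameter set as the set of normal forms\<close>

lemma V_nm_coord_1:
  assumes "v \<in> V_nm n m" shows "coord v 1 \<in> \<real> \<or> coord v 1 \<in> R1plus"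
proof -
  obtain A where A: "A \<in> {0..pi/2}" "coord v 1 = - quat_of_complex (exp (- \<i> * complex_of_real A))"
    using assms by (auto simp: V_nm_def)
  have "sin A \<ge> 0" using A(1) by (intro sin_ge_zero) auto
  moreover have "coord v 1 = Quat (- cos A) (sin A) 0 0"
    using A(2) by (simp add: quat_of_complex_def uminus_quat_def Re_exp Im_exp)
  ultimately show ?thesis by (auto simp: Reals_quat R1plus_iff)
qed

text \<open>The families sort the normal forms by the positions of their first non-real entry i and
  first non-complex entry j: i = 1 for the P families, i at least 2 or absent for the Z
  families.\<close>

lemma M_nm_eq:
  assumes N: "1 \<le> NN m"
  shows "M_nm n m = {v \<in> V_nm n m. normal_form (NN m) v}"
proof (rule subset_antisym; rule subsetI)
  fix v assume M: "v \<in> M_nm n m"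
  then have V: "v \<in> V_nm n m" using M_subset_V by blast
  note v1 = V_nm_coord_1[OF V]
  \<comment> \<open>In the P families the first coordinate itself is the first non-real
    entry.\<close>
  have real1: "\<exists>i\<in>{1..NN m}. (\<forall>l\<in>{1..<i}. coord v l \<in> \<real>) \<and> coord v i \<in> R1plus"
    if "coord v 1 \<notin> \<real>"
    using that v1 N by (intro bexI[of _ 1]) auto
  from M consider "v \<in> P_C n m" | j where "j \<in> {2..NN m}" "v \<in> P_j n m j" | "v \<in> Z_R n m"
    | i where "i \<in> {2..NN m}" "v \<in> Z_C n m i"
    | i j where "j \<in> {2..NN m}" "i \<in> {2..<j}" "v \<in> Z_ij n m i j"
    unfolding M_nm_def P_nm_def Z_nm_def by blast
  note cases_M = this
  from cases_M have "(\<forall>l\<in>{1..NN m}. coord v l \<in> \<real>) \<or>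
        (\<exists>i\<in>{1..NN m}. (\<forall>l\<in>{1..<i}. coord v l \<in> \<real>) \<and> coord v i \<in> R1plus)"
  proof cases
    case 1
    then show ?thesis using real1 by (simp add: P_C_def)
  next
    case (2 j)
    then show ?thesis using real1 by (simp add: P_j_def)
  next
    case 3
    then show ?thesis by (simp add: Z_R_def)
  next
    case (4 i)
    then have "i \<in> {1..NN m}" by auto
    with 4 show ?thesis unfolding Z_C_def by blast
  next
    case (5 i j)
    then have "i \<in> {1..NN m}" by auto
    with 5 show ?thesis unfolding Z_ij_def by blast
  qed
  moreover have "(\<forall>l\<in>{1..NN m}. coord v l \<in> qComplex) \<or>
        (\<exists>j\<in>{1..NN m}. (\<forall>l\<in>{1..<j}. coord v l \<in> qComplex) \<and> coord v j \<in> R2plus)"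
  proof -
    have c1: "coord v 1 \<in> qComplex" using v1 Reals_complex R1plus_complex by blast
    from cases_M show ?thesis
    proof cases
      case 1
      have "coord v l \<in> qComplex" if "l \<in> {1..NN m}" for l
        using 1 c1 that by (cases "l = 1") (auto simp: P_C_def)
      then show ?thesis by blast
    next
      case 3
      then show ?thesis using Reals_complex by (auto simp: Z_R_def)
    next
      case (4 i)
      have "coord v l \<in> qComplex" if "l \<in> {1..NN m}" for l
        using 4 Reals_complex R1plus_complex that
        by (cases l i rule: linorder_cases) (auto simp: Z_C_def)
      then show ?thesis by blast
    next
      case (2 j)
      then have "j \<in> {1..NN m}" by auto
      with 2 show ?thesis unfolding P_j_def by blast
    next
      case (5 i j)
      then have "j \<in> {1..NN m}" by auto
      with 5 show ?thesis unfolding Z_ij_def by blast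
    qed
  qed
  ultimately have "normal_form (NN m) v"
    by (rule normal_formI)
  with V show "v \<in> {v \<in> V_nm n m. normal_form (NN m) v}" by simp
next
  fix v assume "v \<in> {v \<in> V_nm n m. normal_form (NN m) v}"
  then have V: "v \<in> V_nm n m" and nf: "normal_form (NN m) v" by auto
  note v1 = V_nm_coord_1[OF V]
  have c1: "coord v 1 \<in> qComplex" using v1 Reals_complex R1plus_complex by blast
  have J: "(\<forall>l\<in>{1..NN m}. coord v l \<in> qComplex) \<or>
        (\<exists>j\<in>{2..NN m}. (\<forall>l\<in>{1..<j}. coord v l \<in> qComplex) \<and> coord v j \<in> R2plus)"
  proof (rule first_failure[of "NN m" "\<lambda>l. coord v l \<in> qComplex"])
    fix j assume j: "j \<in> {1..NN m}" "\<forall>l\<in>{1..<j}. coord v l \<in> qComplex" "coord v j \<notin> qComplex"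
    then have "j \<noteq> 1" using c1 by auto
    with j have "j \<in> {2..NN m}" by auto
    moreover have "coord v j \<in> R2plus" using nf j unfolding normal_form_def by blast
    ultimately show ?thesis using j by blast
  qed blast
  have "v \<in> P_nm n m \<or> v \<in> Z_nm n m"
  proof (cases "coord v 1 \<in> \<real>")
    case False
    then have "v \<in> P_nm n m"
      using J V unfolding P_nm_def P_C_def P_j_def by auto
    then show ?thesis ..
  next
    case True
    have "v \<in> Z_nm n m"
    proof (rule first_failure[of "NN m" "\<lambda>l. coord v l \<in> \<real>"])
      assume "\<forall>l\<in>{1..NN m}. coord v l \<in> \<real>"
      then show ?thesis using V unfolding Z_nm_def Z_R_def by blast
    next
      fix i assume i: "i \<in> {1..NN m}" "\<forall>l\<in>{1..<i}. coord v l \<in> \<real>" "coord v i \<notin> \<real>"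
      then have "i \<noteq> 1" using True by auto
      with i have i2: "i \<in> {2..NN m}" by auto
      have vi: "coord v i \<in> R1plus" using nf i unfolding normal_form_def by blast
      from J show ?thesis
      proof
        assume "\<forall>l\<in>{1..NN m}. coord v l \<in> qComplex"
        then have "v \<in> Z_C n m i" using V i vi unfolding Z_C_def by auto
        then show ?thesis using i2 unfolding Z_nm_def by blast
      next
        assume "\<exists>j\<in>{2..NN m}. (\<forall>l\<in>{1..<j}. coord v l \<in> qComplex) \<and> coord v j \<in> R2plus"
        then obtain j where j: "j \<in> {2..NN m}" "\<forall>l\<in>{1..<j}. coord v l \<in> qComplex" "coord v j \<in> R2plus"
          by blast
        have "coord v j \<notin> qComplex" using R2plus_not_complex[OF j(3)] .
        \<comment> \<open>Every entry up to i is complex, being real before i and in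
          \<open>R1plus\<close> at i, whereas the entry at j is not.\<close>
        then have "i < j"
          using i(2) j(1) vi Reals_complex R1plus_complex
          by (cases i j rule: linorder_cases) auto
        then have "i \<in> {2..<j}" using i2 by auto
        moreover have "v \<in> Z_ij n m i j" using V i vi j unfolding Z_ij_def by blast
        ultimately show ?thesis using j(1) unfolding Z_nm_def by blast
      qed
    qed
    then show ?thesis ..
  qed
  then show "v \<in> M_nm n m" by (simp add: M_nm_def)
qed

section \<open>Representatives of orbits\<close>

lemma orbit_of_eq: "orbit_of v = (\<lambda>\<mu>. map_vec (qconj \<mu>) v) ` Sp1"
  by (auto simp: orbit_of_def qconj_def[abs_def])

lemma map_vec_qconj_qconj:
  "\<mu> \<noteq> 0 \<Longrightarrow> \<nu> \<noteq> 0 \<Longrightarrow> map_vec (qconj \<mu>) (map_vec (qconj \<nu>) v) = map_vec (qconj (\<mu> * \<nu>)) v"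
  by (rule eq_vecI) (simp_all add: qconj_mult_left)

lemma self_in_orbit: "v \<in> orbit_of v"
proof -
  have "v = map_vec (qconj 1) v" by (rule eq_vecI) auto
  then show ?thesis unfolding orbit_of_eq using one_in_Sp1 by blast
qed

lemma orbit_of_subset: "w \<in> orbit_of v \<Longrightarrow> orbit_of w \<subseteq> orbit_of v"
  by (auto simp: orbit_of_eq map_vec_qconj_qconj Sp1_nonzero intro!: imageI Sp1_mult)

lemma orbit_of_sym:
  assumes "w \<in> orbit_of v" shows "v \<in> orbit_of w"
proof -
  obtain \<mu> where \<mu>: "\<mu> \<in> Sp1" "w = map_vec (qconj \<mu>) v" using assms by (auto simp: orbit_of_eq)
  have "v = map_vec (qconj (inverse \<mu>)) w"
    unfolding \<mu>(2) using Sp1_nonzero[OF \<mu>(1)]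
    by (intro eq_vecI) (simp_all add: qconj_inverse_left)
  then show ?thesis unfolding orbit_of_eq using Sp1_inverse[OF \<mu>(1)] by blast
qed

lemma orbit_of_eq_iff: "orbit_of v = orbit_of w \<longleftrightarrow> w \<in> orbit_of v"
  using orbit_of_subset orbit_of_sym self_in_orbit by blast

text \<open>The inverse map sends a representative to its class.\<close>

lemma equiv_unique_representatives_bij:
  assumes "equiv V r" "M \<subseteq> V" and ex1: "\<forall>C \<in> V // r. \<exists>!v. v \<in> C \<and> v \<in> M"
  shows "bij_betw (\<lambda>C. THE v. v \<in> C \<and> v \<in> M) (V // r) M"
proof (rule bij_betw_byWitness[where f' = "\<lambda>v. r `` {v}"])
  have *: "(THE v. v \<in> C \<and> v \<in> M) \<in> C" "(THE v. v \<in> C \<and> v \<in> M) \<in> M" if "C \<in> V // r" for C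
    using theI'[OF bspec[OF ex1 that]] by auto
  show "\<forall>C\<in>V // r. r `` {THE v. v \<in> C \<and> v \<in> M} = C"
  proof
    fix C assume C: "C \<in> V // r"
    then obtain x where x: "C = r `` {x}" by (rule quotientE)
    let ?v = "THE v. v \<in> C \<and> v \<in> M"
    have "?v \<in> r `` {x}" using *(1)[OF C] by (simp only: x[symmetric])
    then have "(x, ?v) \<in> r" by (rule Image_singleton_iff[THEN iffD1])
    then show "r `` {?v} = C" using equiv_class_eq[OF assms(1), of x ?v] by (simp only: x[symmetric])
  qed
  show "(\<lambda>C. THE v. v \<in> C \<and> v \<in> M) ` (V // r) \<subseteq> M" using *(2) by blast
  show "(\<lambda>v. r `` {v}) ` M \<subseteq> V // r" using assms(2) by (auto intro: quotientI)
  show "\<forall>v\<in>M. (THE w. w \<in> r `` {v} \<and> w \<in> M) = v"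
  proof
    fix v assume v: "v \<in> M"
    then have "v \<in> V" using assms(2) by blast
    then have "\<exists>!w. w \<in> r `` {v} \<and> w \<in> M" "v \<in> r `` {v}"
      using ex1 quotientI[of v V r] equiv_class_self[OF assms(1)] by auto
    then show "(THE w. w \<in> r `` {v} \<and> w \<in> M) = v" using v by (intro the1_equality) auto
  qed
qed

text \<open>The first conjunct guarantees that the description \<open>THE\<close> in the second
  really denotes a representative of the class.\<close>

theorem theorem3p1:
  fixes n m :: nat
  assumes "0 < n" and "4 < m"
  shows "(\<forall>C \<in> V_nm n m // orb_rel n m. \<exists>!v. v \<in> C \<and> v \<in> M_nm n m) \<and>
         bij_betw (\<lambda>C. THE v. v \<in> C \<and> v \<in> M_nm n m) (V_nm n m // orb_rel n m) (M_nm n m)"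
proof -
  \<comment> \<open>The entry in row 1 and column 3 exists, so the vectors have a first
    coordinate.\<close>
  have "gram_pos 1 3 \<in> {1..NN m}" using assms by (intro gram_pos_bounds) auto
  then have N: "1 \<le> NN m" by auto
  have carrier: "v \<in> carrier_vec (NN m)" if "v \<in> V_nm n m" for v using that by (simp add: V_nm_def)
  have ex1: "\<forall>C \<in> V_nm n m // orb_rel n m. \<exists>!v. v \<in> C \<and> v \<in> M_nm n m"
  proof
    fix C assume "C \<in> V_nm n m // orb_rel n m"
    then obtain x where x: "x \<in> V_nm n m" "C = orb_rel n m `` {x}" by (auto elim: quotientE)
    have C: "y \<in> C \<longleftrightarrow> y \<in> V_nm n m \<and> y \<in> orbit_of x" for y
      using x by (auto simp: orb_rel_def orbit_of_eq_iff)
    obtain \<mu> where \<mu>: "\<mu> \<in> Sp1" "coord (map_vec (qconj \<mu>) x) 1 = coord x 1"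
      "normal_form (NN m) (map_vec (qconj \<mu>) x)"
      using ex_normal_form[OF carrier[OF x(1)] N V_nm_coord_1[OF x(1)]] by blast
    have "map_vec (qconj \<mu>) x \<in> V_nm n m" by (rule V_nm_qconj[OF \<mu>(1) x(1) \<mu>(2)])
    then have "map_vec (qconj \<mu>) x \<in> C \<and> map_vec (qconj \<mu>) x \<in> M_nm n m"
      using \<mu> by (auto simp: C M_nm_eq[OF N] orbit_of_eq)
    moreover have "y = z" if "y \<in> C \<and> y \<in> M_nm n m" "z \<in> C \<and> z \<in> M_nm n m" for y z
    proof -
      \<comment> \<open>Two normal forms in one class differ by a single conjugation, so
        \<open>normal_form_unique\<close> applies.\<close>
      have "z \<in> orbit_of y" using that by (metis C orbit_of_eq_iff)
      then obtain \<nu> where "\<nu> \<in> Sp1" "z = map_vec (qconj \<nu>) y" by (auto simp: orbit_of_eq)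
      then show ?thesis
        using that normal_form_unique[of y "NN m" \<nu>] carrier by (auto simp: M_nm_eq[OF N])
    qed
    ultimately show "\<exists>!v. v \<in> C \<and> v \<in> M_nm n m" by blast
  qed
  with equiv_unique_representatives_bij[OF equiv_orb_rel M_subset_V ex1] show ?thesis by blast
qed

end
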